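(* There is an absolute constant $c>0$ such that the following holds. Let $G,B,\kappa\ge0$ be constants with $\kappa B^2<1$. Then there exist a distributed optimization problem (numbers $n$ and $b<n/2$, a set $\mathcal H$ of $h=n-b$ honest workers, and local objectives $f_i$) for which (i) $f_{\mathcal H}$ is smooth with parameter $\mu$ and satisfies the PL condition with the same parameter $\mu$, for some $\mu>0$, and (ii) the honest local objectives satisfy the $(G,B)$-bounded dissimilarity condition, and a $(b,\kappa)$-robust aggregation rule $\mathcal A$, such that for every admissible choice of stepsizes and momentum parameters (as listed in the context) and every initial point $x^0$, if the number of iterations $T$ is sufficiently large, then the last iterate $x^{T-1}$ generated by R-DGD or R-DGD-M with the rule $\mathcal A$ satisfies $$\|\nabla f_{\mathcal H}(x^{T-1})\|^2\ge c\,\frac{\kappa G^2}{1-\kappa B^2},\qquad f_{\mathcal H}(x^{T-1})-f_{\mathcal H}(x^* )\ge c\,\frac{\kappa G^2}{\mu(1-\kappa B^2)},$$ where $x^*$ is a minimizer of $f_{\mathcal H}$.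
   Context: Setting. There are $n$ workers and a central server; $b<n/2$ workers may be Byzantine ($b=0$ is allowed). $\mathcal H\subset[n]$ is the set of honest workers, $|\mathcal H|=h=n-b$. Worker $i$ has differentiable local objective $f_i:\mathbb R^d\to\mathbb R$; $f_{\mathcal H}=\frac1h\sum_{i\in\mathcal H}f_i$ and $f_{\mathcal H}^*=\inf f_{\mathcal H}>-\infty$. R-DGD-M (deterministic gradients). Given $x^0\in\mathbb R^d$, $m_i^0=0$ for $i\in\mathcal H$, stepsizes $\gamma_t>0$, momentum parameters $\beta_t\in[0,1]$ and an aggregation rule $\mathcal A:\mathbb R^{d\times n}\to\mathbb R^d$: for $t=1,2,\dots$, each honest worker sends $m_i^t=\beta_tm_i^{t-1}+(1-\beta_t)\nabla f_i(x^{t-1})$; each Byzantine worker $j$ sends an arbitrary vector $m_j^t$; the server sets $x^t=x^{t-1}-\gamma_t\mathcal A(m_1^t,\dots,m_n^t)$. R-DGD is the case $\beta_t\equiv0$. Smooth with parameter $L$: $\nabla f_{\mathcal H}$ is $L$-Lipschitz (here $L=\mu$). PL with parameter $\mu$: $\|\nabla f_{\mathcal H}(x)\|^2\ge2\mu(f_{\mathcal H}(x)-f_{\mathcal H}^* )$ for all $x$. $(G,B)$-bounded dissimilarity: $\frac1h\sum_{i\in\mathcal H}\|\nabla f_i(x)-\nabla f_{\mathcal H}(x)\|^2\le G^2+B^2\|\nabla f_{\mathcal H}(x)\|^2$ for all $x$. $(b,\kappa)$-robustness: for all $x_1,\dots,x_n\in\mathbb R^d$ and every $S\subset[n]$ with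 $|S|=n-b$, $\|\mathcal A(x_1,\dots,x_n)-\bar x_S\|^2\le\frac{\kappa}{n-b}\sum_{i\in S}\|x_i-\bar x_S\|^2$, where $\bar x_S=\frac1{n-b}\sum_{i\in S}x_i$. Admissible choices of stepsizes and momentum parameters for horizon $T$ (with $L=\mu$ the smoothness parameter): (a) R-DGD, constant stepsize $\gamma_t\equiv\gamma$, where either $\gamma\in(0,\delta/L]$ is fixed independently of $T$, or $\gamma=\gamma_0/\sqrt T$ with fixed $\gamma_0\in(0,\delta/L]$, for some $\delta\in(0,1/4)$ with $\kappa B^2<\frac{1-4\delta}{1+2\delta}$; (b) R-DGD, $\gamma_t=\gamma_0$ for $t<\lfloor T/2\rfloor$ and $\gamma_t=\frac{2}{\alpha(s_0+t-\lfloor T/2\rfloor)}$ for $t\ge\lfloor T/2\rfloor$, with fixed $\alpha>0$, $s_0>2$ and $\gamma_0=\frac2{\alpha s_0}\le\delta/L$, for $\delta$ as in (a); (c) R-DGD-M, constant stepsize $\gamma_t\equiv\gamma$, where either $\gamma\in(0,1/(32L)]$ is fixed independently of $T$ or $\gamma=\gamma_0/\sqrt T$ with fixed $\gamma_0\in(0,1/(32L)]$, and $\beta_t\equiv1-32\gamma L$; (d) R-DGD-M, stepsizes of the form in (b) but with $\gamma_0=\frac{2}{\alpha s_0}\le1/(32L)$, and $\beta_t=1-32\gamma_tL$. "Sufficiently large $T$" means $T\ge T_0$, where $T_0$ may depend on the problem, on $x^0$ and on the fixed parameters of the chosen schedule. *)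

theory Defs
  imports Complex_Main "Jordan_Normal_Form.Matrix"
begin

(* The dimension d is itself existentially quantified in the statement, so R^d is
   carrier_vec d; an element of R^{d x n} is a matrix in carrier_mat d n whose columns
   are the n vectors. Workers are numbered 0, ..., n - 1. *)

definition vnorm :: "real vec \<Rightarrow> real" where
  "vnorm v = sqrt (v \<bullet> v)"

definition has_gradient_at :: "nat \<Rightarrow> (real vec \<Rightarrow> real) \<Rightarrow> real vec \<Rightarrow> real vec \<Rightarrow> bool" where
  "has_gradient_at d f x g \<longleftrightarrow> g \<in> carrier_vec d \<and>
     (\<forall>e>0. \<exists>r>0. \<forall>y\<in>carrier_vec d. vnorm (y - x) < r \<longrightarrow>
        \<bar>f y - f x - g \<bullet> (y - x)\<bar> \<le> e * vnorm (y - x))"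

definition differentiable_everywhere :: "nat \<Rightarrow> (real vec \<Rightarrow> real) \<Rightarrow> bool" where
  "differentiable_everywhere d f \<longleftrightarrow> (\<forall>x\<in>carrier_vec d. \<exists>g. has_gradient_at d f x g)"

definition gradient :: "nat \<Rightarrow> (real vec \<Rightarrow> real) \<Rightarrow> real vec \<Rightarrow> real vec" where
  "gradient d f x = (THE g. has_gradient_at d f x g)"

lemma has_gradient_at_unique:
  assumes x: "x \<in> carrier_vec d"
    and g: "has_gradient_at d f x g" and g': "has_gradient_at d f x g'"
  shows "g = g'"
proof -
  define w where "w = g - g'"
  have gc: "g \<in> carrier_vec d" "g' \<in> carrier_vec d"
    using g g' by (auto simp: has_gradient_at_def)
  hence wc: "w \<in> carrier_vec d" by (simp add: w_def)
  have ww: "w \<bullet> w = (\<Sum>k<d. (w $ k)\<^sup>2)"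
    using wc by (simp add: scalar_prod_def power2_eq_square lessThan_atLeast0)
  have "vnorm w \<le> 0"
  proof (rule ccontr)
    assume "\<not> vnorm w \<le> 0"
    hence pos: "vnorm w > 0" by simp
    define e where "e = vnorm w / 4"
    have e: "e > 0" using pos by (simp add: e_def)
    obtain r where r: "r > 0" "\<And>y. y \<in> carrier_vec d \<Longrightarrow> vnorm (y - x) < r \<Longrightarrow>
        \<bar>f y - f x - g \<bullet> (y - x)\<bar> \<le> e * vnorm (y - x)"
      using g e unfolding has_gradient_at_def by blast
    obtain r' where r': "r' > 0" "\<And>y. y \<in> carrier_vec d \<Longrightarrow> vnorm (y - x) < r' \<Longrightarrow>
        \<bar>f y - f x - g' \<bullet> (y - x)\<bar> \<le> e * vnorm (y - x)"
      using g' e unfolding has_gradient_at_def by blast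
    define s where "s = min r r' / (2 * vnorm w)"
    have s: "s > 0" using r r' pos by (simp add: s_def)
    define y where "y = x + s \<cdot>\<^sub>v w"
    have yc: "y \<in> carrier_vec d" using x wc by (simp add: y_def)
    have yx: "y - x = s \<cdot>\<^sub>v w" using x wc by (auto simp: y_def)
    have ny: "vnorm (y - x) = s * vnorm w"
      using s wc by (simp add: yx vnorm_def real_sqrt_mult)
    have "s * vnorm w = min r r' / 2" using pos by (simp add: s_def)
    hence "vnorm (y - x) < r" "vnorm (y - x) < r'" using ny r r' by auto
    from r(2)[OF yc this(1)] r'(2)[OF yc this(2)]
    have "\<bar>g \<bullet> (y - x) - g' \<bullet> (y - x)\<bar> \<le> 2 * e * vnorm (y - x)" by linarith
    moreover have "g \<bullet> (y - x) - g' \<bullet> (y - x) = s * (w \<bullet> w)"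
      using gc wc by (simp add: yx w_def minus_scalar_prod_distrib[of _ d] algebra_simps)
    moreover have "w \<bullet> w = vnorm w * vnorm w"
      using ww by (simp add: vnorm_def sum_nonneg)
    ultimately have "s * (vnorm w * vnorm w) \<le> s * (vnorm w * vnorm w) / 2"
      using s pos ny by (simp add: e_def)
    thus False using s pos by simp
  qed
  hence "w \<bullet> w = 0" using ww by (simp add: vnorm_def sum_nonneg antisym)
  hence "\<And>k. k < d \<Longrightarrow> w $ k = 0" using ww by (simp add: sum_nonneg_eq_0_iff)
  hence "\<And>k. k < d \<Longrightarrow> g $ k = g' $ k" using gc by (simp add: w_def)
  thus ?thesis using gc by auto
qed

definition honest_objective :: "nat set \<Rightarrow> (nat \<Rightarrow> real vec \<Rightarrow> real) \<Rightarrow> real vec \<Rightarrow> real" where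
  "honest_objective H f x = (\<Sum>i\<in>H. f i x) / real (card H)"

definition distributed_problem ::
    "nat \<Rightarrow> nat \<Rightarrow> nat \<Rightarrow> nat set \<Rightarrow> (nat \<Rightarrow> real vec \<Rightarrow> real) \<Rightarrow> bool" where
  "distributed_problem d n b H f \<longleftrightarrow>
     0 < d \<and> 2 * b < n \<and> H \<subseteq> {..<n} \<and> card H = n - b \<and>
     (\<forall>i<n. differentiable_everywhere d (f i)) \<and>
     bdd_below (honest_objective H f ` carrier_vec d)"

definition smooth :: "nat \<Rightarrow> real \<Rightarrow> (real vec \<Rightarrow> real) \<Rightarrow> bool" where
  "smooth d L F \<longleftrightarrow> (\<forall>x\<in>carrier_vec d. \<forall>y\<in>carrier_vec d.
     vnorm (gradient d F x - gradient d F y) \<le> L * vnorm (x - y))"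

definition PL_condition :: "nat \<Rightarrow> real \<Rightarrow> (real vec \<Rightarrow> real) \<Rightarrow> bool" where
  "PL_condition d \<mu> F \<longleftrightarrow> (\<forall>x\<in>carrier_vec d.
     (vnorm (gradient d F x))\<^sup>2 \<ge> 2 * \<mu> * (F x - (INF y\<in>carrier_vec d. F y)))"

definition bounded_dissimilarity ::
    "nat \<Rightarrow> nat set \<Rightarrow> (nat \<Rightarrow> real vec \<Rightarrow> real) \<Rightarrow> real \<Rightarrow> real \<Rightarrow> bool" where
  "bounded_dissimilarity d H f G B \<longleftrightarrow> (\<forall>x\<in>carrier_vec d.
     (\<Sum>i\<in>H. (vnorm (gradient d (f i) x - gradient d (honest_objective H f) x))\<^sup>2) / real (card H)
       \<le> G\<^sup>2 + B\<^sup>2 * (vnorm (gradient d (honest_objective H f) x))\<^sup>2)"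

definition column_mean :: "nat \<Rightarrow> nat set \<Rightarrow> real mat \<Rightarrow> real vec" where
  "column_mean d S X = (1 / real (card S)) \<cdot>\<^sub>v finsum_vec TYPE(real) d (col X) S"

definition aggregation_rule :: "nat \<Rightarrow> nat \<Rightarrow> (real mat \<Rightarrow> real vec) \<Rightarrow> bool" where
  "aggregation_rule d n A \<longleftrightarrow> (\<forall>X\<in>carrier_mat d n. A X \<in> carrier_vec d)"

definition robust ::
    "nat \<Rightarrow> nat \<Rightarrow> nat \<Rightarrow> real \<Rightarrow> (real mat \<Rightarrow> real vec) \<Rightarrow> bool" where
  "robust d n b \<kappa> A \<longleftrightarrow> (\<forall>X\<in>carrier_mat d n. \<forall>S. S \<subseteq> {..<n} \<and> card S = n - b \<longrightarrow>
     (vnorm (A X - column_mean d S X))\<^sup>2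
       \<le> \<kappa> / real (n - b) * (\<Sum>i\<in>S. (vnorm (col X i - column_mean d S X))\<^sup>2))"

(* x 0, ..., x T and m 0, ..., m T form a run of T iterations of R-DGD-M, where m t i is the
   vector sent by worker i in iteration t. The vectors of the workers outside H are
   unconstrained, hence may depend on everything else in the run. *)
definition RDGDM_run ::
    "nat \<Rightarrow> nat \<Rightarrow> nat set \<Rightarrow> (nat \<Rightarrow> real vec \<Rightarrow> real) \<Rightarrow> (real mat \<Rightarrow> real vec) \<Rightarrow>
     (nat \<Rightarrow> real) \<Rightarrow> (nat \<Rightarrow> real) \<Rightarrow> nat \<Rightarrow> real vec \<Rightarrow>
     (nat \<Rightarrow> real vec) \<Rightarrow> (nat \<Rightarrow> nat \<Rightarrow> real vec) \<Rightarrow> bool" where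
  "RDGDM_run d n H f A \<gamma> \<beta> T x0 x m \<longleftrightarrow>
     x 0 = x0 \<and> (\<forall>i\<in>H. m 0 i = 0\<^sub>v d) \<and>
     (\<forall>t\<in>{1..T}.
        (\<forall>i\<in>H. m t i = \<beta> t \<cdot>\<^sub>v m (t - 1) i + (1 - \<beta> t) \<cdot>\<^sub>v gradient d (f i) (x (t - 1))) \<and>
        (\<forall>j\<in>{..<n} - H. m t j \<in> carrier_vec d) \<and>
        x t = x (t - 1) - \<gamma> t \<cdot>\<^sub>v A (mat_of_cols d (map (m t) [0..<n])))"

definition two_phase_stepsize :: "real \<Rightarrow> real \<Rightarrow> nat \<Rightarrow> nat \<Rightarrow> real" where
  "two_phase_stepsize \<alpha> s0 T t =
     (if t < T div 2 then 2 / (\<alpha> * s0)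
      else 2 / (\<alpha> * (s0 + real t - real (T div 2))))"

definition admissible_delta :: "real \<Rightarrow> real \<Rightarrow> real \<Rightarrow> bool" where
  "admissible_delta \<kappa> B \<delta> \<longleftrightarrow>
     0 < \<delta> \<and> \<delta> < 1 / 4 \<and> \<kappa> * B\<^sup>2 < (1 - 4 * \<delta>) / (1 + 2 * \<delta>)"

(* The last two arguments are whole families: they map the horizon T and the iteration t to the
   stepsize and to the momentum parameter. The parameters of a schedule are thereby fixed before T.
   Momentum identically 0 is R-DGD. *)
inductive admissible_schedule ::
    "real \<Rightarrow> real \<Rightarrow> real \<Rightarrow> (nat \<Rightarrow> nat \<Rightarrow> real) \<Rightarrow> (nat \<Rightarrow> nat \<Rightarrow> real) \<Rightarrow> bool"
  for \<kappa> B L :: real where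
  RDGD_const:
    "admissible_delta \<kappa> B \<delta> \<Longrightarrow> 0 < \<gamma>0 \<Longrightarrow> \<gamma>0 \<le> \<delta> / L \<Longrightarrow>
     admissible_schedule \<kappa> B L (\<lambda>T t. \<gamma>0) (\<lambda>T t. 0)"
| RDGD_sqrt:
    "admissible_delta \<kappa> B \<delta> \<Longrightarrow> 0 < \<gamma>0 \<Longrightarrow> \<gamma>0 \<le> \<delta> / L \<Longrightarrow>
     admissible_schedule \<kappa> B L (\<lambda>T t. \<gamma>0 / sqrt (real T)) (\<lambda>T t. 0)"
| RDGD_two_phase:
    "admissible_delta \<kappa> B \<delta> \<Longrightarrow> 0 < \<alpha> \<Longrightarrow> 2 < s0 \<Longrightarrow> 2 / (\<alpha> * s0) \<le> \<delta> / L \<Longrightarrow>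
     admissible_schedule \<kappa> B L (two_phase_stepsize \<alpha> s0) (\<lambda>T t. 0)"
| RDGDM_const:
    "0 < \<gamma>0 \<Longrightarrow> \<gamma>0 \<le> 1 / (32 * L) \<Longrightarrow>
     admissible_schedule \<kappa> B L (\<lambda>T t. \<gamma>0) (\<lambda>T t. 1 - 32 * \<gamma>0 * L)"
| RDGDM_sqrt:
    "0 < \<gamma>0 \<Longrightarrow> \<gamma>0 \<le> 1 / (32 * L) \<Longrightarrow>
     admissible_schedule \<kappa> B L (\<lambda>T t. \<gamma>0 / sqrt (real T))
       (\<lambda>T t. 1 - 32 * (\<gamma>0 / sqrt (real T)) * L)"
| RDGDM_two_phase:
    "0 < \<alpha> \<Longrightarrow> 2 < s0 \<Longrightarrow> 2 / (\<alpha> * s0) \<le> 1 / (32 * L) \<Longrightarrow>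
     admissible_schedule \<kappa> B L (two_phase_stepsize \<alpha> s0)
       (\<lambda>T t. 1 - 32 * two_phase_stepsize \<alpha> s0 T t * L)"

end

theory Submission
  imports Defs "HOL-Real_Asymp.Real_Asymp"
begin

text \<open>
  Two honest workers on the real line and no Byzantine ones already produce the bound, because a
  robust rule need not be exact in the absence of attackers: it may miss the mean of its inputs by
  \<open>sqrt \<kappa>\<close> times their standard deviation. For two scalars that allowance is
  \<open>sqrt \<kappa> * \<bar>u - v\<bar> / 2\<close>, and a rule that always errs in the direction of the second
  worker, \<open>(u + v) / 2 - sqrt \<kappa> * (u - v) / 2\<close>, uses it up while remaining linear.

  Let the workers have gradients \<open>x + D x\<close> and \<open>x - D x\<close>, so that the honest objective is
  \<open>x\<^sup>2 / 2\<close> and \<open>\<mu> = 1\<close>. The rule then returns \<open>x - sqrt \<kappa> * D x\<close>, and the method is driven to a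
  point with \<open>x = sqrt \<kappa> * D x\<close> instead of to the minimizer \<open>0\<close>. If \<open>D x\<close> were
  \<open>sqrt (G\<^sup>2 + B\<^sup>2 * x\<^sup>2)\<close>, the largest value that \<open>(G, B)\<close>-dissimilarity admits, this point would
  satisfy \<open>x\<^sup>2 = \<kappa> * G\<^sup>2 / (1 - \<kappa> * B\<^sup>2)\<close>. The point depends only
  on the value of \<open>D\<close> there, so the tangent line of the hyperbola at that point leads to the same
  bias; its absolute value stays below the hyperbola, and it makes all objectives quadratic. Its
  slope and intercept come from Cauchy-Schwarz, see \<open>tangent_line_below_hyperbola\<close>.

  Everything is now linear. With \<open>\<rho> = 1 - \<kappa> * B\<^sup>2\<close>, the offset \<open>e\<close> from the biased fixed point and
  the aggregated momentum \<open>a\<close> evolve like a heavy-ball method for \<open>\<rho> * e\<^sup>2 / 2\<close>. The quantity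
  \<open>\<bar>e\<bar> + \<bar>a - \<rho> * e\<bar> / 2\<close> shrinks by the factor \<open>1 - \<rho> * \<gamma> / 2\<close> in each step
  (\<open>momentum_step_contracts\<close>) as soon as \<open>4 * \<gamma> \<le> 1 - \<beta>\<close>, which covers all schedules, with and
  without momentum. The stepsizes of every schedule have a sum that tends to infinity with the
  horizon (\<open>admissible_stepsizes_sum_diverges\<close>), hence the last iterate gets within half of the
  bias of the biased fixed point.
\<close>

section \<open>Quadratic functions on the line\<close>

(* The dimension has to keep the form 1 for facts about carrier_vec 1 to apply. *)
declare One_nat_def [simp del]

definition quadratic :: "real \<Rightarrow> real \<Rightarrow> real vec \<Rightarrow> real" where
  "quadratic r s x = r / 2 * (x $ 0)\<^sup>2 + s * x $ 0"

lemma scalar_prod_line: "w \<in> carrier_vec 1 \<Longrightarrow> v \<bullet> w = v $ 0 * w $ 0"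
  by (simp add: scalar_prod_def One_nat_def)

lemma vnorm_line: "v \<in> carrier_vec 1 \<Longrightarrow> vnorm v = \<bar>v $ 0\<bar>"
  by (simp add: vnorm_def scalar_prod_line)

lemma has_gradient_at_quadratic:
  assumes x: "x \<in> carrier_vec 1"
  shows "has_gradient_at 1 (quadratic r s) x (vec 1 (\<lambda>_. r * x $ 0 + s))"
  unfolding has_gradient_at_def
proof (intro conjI allI impI)
  show "vec 1 (\<lambda>_. r * x $ 0 + s) \<in> carrier_vec 1" by simp
next
  fix e :: real assume e: "0 < e"
  show "\<exists>\<epsilon>>0. \<forall>y\<in>carrier_vec 1. vnorm (y - x) < \<epsilon> \<longrightarrow>
      \<bar>quadratic r s y - quadratic r s x - vec 1 (\<lambda>_. r * x $ 0 + s) \<bullet> (y - x)\<bar>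
        \<le> e * vnorm (y - x)"
  proof (intro exI[of _ "e / (\<bar>r\<bar> + 1)"] conjI ballI impI)
    show "0 < e / (\<bar>r\<bar> + 1)" using e by (simp add: add_nonneg_pos)
  next
    fix y :: "real vec" assume y: "y \<in> carrier_vec 1" and near: "vnorm (y - x) < e / (\<bar>r\<bar> + 1)"
    define h where "h = y $ 0 - x $ 0"
    have h: "vnorm (y - x) = \<bar>h\<bar>" using x y by (simp add: vnorm_line h_def)
    have "quadratic r s y - quadratic r s x - vec 1 (\<lambda>_. r * x $ 0 + s) \<bullet> (y - x) = r / 2 * h * h"
      using x y
      by (simp add: quadratic_def h_def scalar_prod_line power2_eq_square field_simps)
    moreover have "\<bar>r / 2 * h\<bar> \<le> e"
    proof -
      have "(\<bar>r\<bar> + 1) * \<bar>h\<bar> < e" using near h by (simp add: field_simps add_nonneg_pos)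
      moreover have "\<bar>r / 2 * h\<bar> \<le> (\<bar>r\<bar> + 1) * \<bar>h\<bar>"
        unfolding abs_mult by (rule mult_right_mono) auto
      ultimately show ?thesis by linarith
    qed
    ultimately show "\<bar>quadratic r s y - quadratic r s x - vec 1 (\<lambda>_. r * x $ 0 + s) \<bullet> (y - x)\<bar>
        \<le> e * vnorm (y - x)"
      by (simp only: h abs_mult[of "r / 2 * h" h] mult_right_mono abs_ge_zero)
  qed
qed

lemma gradient_quadratic:
  assumes "x \<in> carrier_vec 1"
  shows "gradient 1 (quadratic r s) x = vec 1 (\<lambda>_. r * x $ 0 + s)"
  unfolding gradient_def
  using has_gradient_at_quadratic[OF assms] has_gradient_at_unique[OF assms] by blast

lemma vnorm_gradient_quadratic:
  "x \<in> carrier_vec 1 \<Longrightarrow> vnorm (gradient 1 (quadratic r s) x) = \<bar>r * x $ 0 + s\<bar>"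
  by (simp add: gradient_quadratic vnorm_line)

lemma smooth_half_square: "smooth 1 1 (quadratic 1 0)"
  by (simp add: smooth_def gradient_quadratic vnorm_line)

lemma PL_condition_half_square: "PL_condition 1 1 (quadratic 1 0)"
proof -
  have "0 \<le> (INF y\<in>carrier_vec 1. quadratic 1 0 y)"
  proof (rule cINF_greatest)
    show "carrier_vec 1 \<noteq> ({} :: real vec set)"
      using zero_carrier_vec by blast
  qed (simp add: quadratic_def)
  then show ?thesis
    by (simp add: PL_condition_def vnorm_gradient_quadratic) (simp add: quadratic_def)
qed

section \<open>Two workers that disagree along a line\<close>

definition two_workers :: "real \<Rightarrow> real \<Rightarrow> nat \<Rightarrow> real vec \<Rightarrow> real" where
  "two_workers p q i = (if i = 0 then quadratic (1 + q) p else quadratic (1 - q) (- p))"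

lemma honest_objective_two_workers:
  "honest_objective {0, 1} (two_workers p q) = quadratic 1 0"
  by (rule ext) (simp add: honest_objective_def two_workers_def quadratic_def field_simps)

lemma distributed_problem_two_workers:
  "distributed_problem 1 2 0 {0, 1} (two_workers p q)"
proof -
  have "bdd_below (quadratic 1 0 ` carrier_vec 1)"
    by (rule bdd_belowI2[of _ 0]) (simp add: quadratic_def)
  moreover have "differentiable_everywhere 1 (two_workers p q i)" for i
    unfolding differentiable_everywhere_def two_workers_def
    using has_gradient_at_quadratic by auto
  ultimately show ?thesis
    by (auto simp: distributed_problem_def
        honest_objective_two_workers)
qed

text \<open>
  Cauchy-Schwarz against the vector \<open>(sqrt (1 - \<kappa> * B\<^sup>2), sqrt \<kappa> * B)\<close>, which has norm 1. Equality
  holds where \<open>(G, B * x)\<close> is parallel to it, namely at \<open>x = sqrt \<kappa> * G / sqrt (1 - \<kappa> * B\<^sup>2)\<close>.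
\<close>
lemma tangent_line_below_hyperbola:
  fixes G B \<kappa> x :: real
  assumes "0 \<le> \<kappa>" "\<kappa> * B\<^sup>2 \<le> 1"
  shows "(G * sqrt (1 - \<kappa> * B\<^sup>2) + sqrt \<kappa> * B\<^sup>2 * x)\<^sup>2 \<le> G\<^sup>2 + B\<^sup>2 * x\<^sup>2"
proof -
  define u v where "u = sqrt (1 - \<kappa> * B\<^sup>2)" and "v = sqrt \<kappa> * B"
  have unit: "u\<^sup>2 + v\<^sup>2 = 1" using assms by (simp add: u_def v_def power_mult_distrib)
  have "(G * u + v * B * x)\<^sup>2 + (G * v - u * B * x)\<^sup>2 = (u\<^sup>2 + v\<^sup>2) * (G\<^sup>2 + B\<^sup>2 * x\<^sup>2)"
    by (simp add: power2_eq_square algebra_simps)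
  moreover have "(G * u + v * B * x)\<^sup>2 \<le> (G * u + v * B * x)\<^sup>2 + (G * v - u * B * x)\<^sup>2"
    by simp
  ultimately have "(G * u + v * B * x)\<^sup>2 \<le> G\<^sup>2 + B\<^sup>2 * x\<^sup>2"
    by (simp only: unit mult_1)
  then show ?thesis by (simp add: u_def v_def power2_eq_square mult.assoc)
qed

lemma bounded_dissimilarity_two_workers:
  assumes "\<And>x. (p + q * x)\<^sup>2 \<le> G\<^sup>2 + B\<^sup>2 * x\<^sup>2"
  shows "bounded_dissimilarity 1 {0, 1} (two_workers p q) G B"
  unfolding bounded_dissimilarity_def honest_objective_two_workers
proof
  fix x :: "real vec" assume x: "x \<in> carrier_vec 1"
  have "vnorm (gradient 1 (two_workers p q i) x - gradient 1 (quadratic 1 0) x)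
      = \<bar>p + q * x $ 0\<bar>" for i
    using x abs_minus_cancel[of "p + q * x $ 0"]
    by (simp add: two_workers_def gradient_quadratic vnorm_line algebra_simps)
  then have "(\<Sum>i\<in>{0, 1}. (vnorm (gradient 1 (two_workers p q i) x
      - gradient 1 (quadratic 1 0) x))\<^sup>2) / real (card {0, 1 :: nat}) = (p + q * x $ 0)\<^sup>2"
    by simp
  then show "(\<Sum>i\<in>{0, 1}. (vnorm (gradient 1 (two_workers p q i) x
      - gradient 1 (quadratic 1 0) x))\<^sup>2) / real (card {0, 1 :: nat})
      \<le> G\<^sup>2 + B\<^sup>2 * (vnorm (gradient 1 (quadratic 1 0) x))\<^sup>2"
    using assms[of "x $ 0"] x by (simp add: vnorm_gradient_quadratic)
qed

section \<open>A linear robust rule that favours the second worker\<close>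

definition biased_mean :: "real \<Rightarrow> real mat \<Rightarrow> real vec" where
  "biased_mean k X = vec 1 (\<lambda>_. ((1 - k) * X $$ (0, 0) + (1 + k) * X $$ (0, 1)) / 2)"

lemma dim_biased_mean [simp]: "dim_vec (biased_mean k X) = 1"
  by (simp add: biased_mean_def)

lemma aggregation_rule_biased_mean: "aggregation_rule 1 2 (biased_mean k)"
  by (simp add: aggregation_rule_def carrier_vecI)

lemma biased_mean_of_cols:
  "biased_mean k (mat_of_cols 1 (map u [0..<2])) $ 0 = ((1 - k) * u 0 $ 0 + (1 + k) * u 1 $ 0) / 2"
  by (simp add: biased_mean_def mat_of_cols_def nth_append)

text \<open>
  The robustness inequality is an equality here: without Byzantine workers the only set to compare
  with is that of all workers, and both sides equal \<open>\<kappa> * (u - v)\<^sup>2 / 4\<close> for inputs \<open>u\<close> and \<open>v\<close>.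
\<close>
lemma robust_biased_mean:
  assumes "0 \<le> \<kappa>"
  shows "robust 1 2 0 \<kappa> (biased_mean (sqrt \<kappa>))"
  unfolding robust_def
proof (intro ballI allI impI)
  fix X :: "real mat" and S :: "nat set"
  assume X: "X \<in> carrier_mat 1 2" and S: "S \<subseteq> {..<2} \<and> card S = 2 - 0"
  have "S = {..<2}" by (rule card_subset_eq) (use S in auto)
  then have S: "S = {0, 1}" by auto
  define u v where "u = X $$ (0, 0)" and "v = X $$ (0, 1)"
  have cols: "col X j \<in> carrier_vec 1" for j using X by (intro carrier_vecI) simp
  have mean: "column_mean 1 S X = vec 1 (\<lambda>_. (u + v) / 2)"
    using X by (auto simp: column_mean_def S finsum_vec_insert[of _ _ _ 1] cols u_def v_def
        finsum_vec_empty)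
  have "(biased_mean (sqrt \<kappa>) X - column_mean 1 S X) $ 0 = sqrt \<kappa> * (v - u) / 2"
    by (simp add: mean biased_mean_def u_def v_def field_simps)
  moreover have "biased_mean (sqrt \<kappa>) X - column_mean 1 S X \<in> carrier_vec 1"
    by (intro carrier_vecI) (simp add: mean)
  ultimately have "vnorm (biased_mean (sqrt \<kappa>) X - column_mean 1 S X) = \<bar>sqrt \<kappa> * (v - u) / 2\<bar>"
    by (simp only: vnorm_line)
  then have "(vnorm (biased_mean (sqrt \<kappa>) X - column_mean 1 S X))\<^sup>2 = (sqrt \<kappa> * (v - u) / 2)\<^sup>2"
    by (simp only: power2_abs)
  also have "\<dots> = \<kappa> * (v - u)\<^sup>2 / 4"
    using assms by (simp add: power_mult_distrib power_divide)
  finally have lhs: "(vnorm (biased_mean (sqrt \<kappa>) X - column_mean 1 S X))\<^sup>2 = \<kappa> * (v - u)\<^sup>2 / 4" .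
  have deviations: "vnorm (col X 0 - column_mean 1 S X) = \<bar>(u - v) / 2\<bar>"
       "vnorm (col X 1 - column_mean 1 S X) = \<bar>(v - u) / 2\<bar>"
    using X by (simp_all add: mean vnorm_line cols u_def v_def field_simps)
  have "(\<Sum>i\<in>S. (vnorm (col X i - column_mean 1 S X))\<^sup>2)
      = (vnorm (col X 0 - column_mean 1 S X))\<^sup>2 + (vnorm (col X 1 - column_mean 1 S X))\<^sup>2"
    by (simp add: S)
  also have "\<dots> = ((u - v) / 2)\<^sup>2 + ((v - u) / 2)\<^sup>2"
    by (simp only: deviations power2_abs)
  also have "\<dots> = (v - u)\<^sup>2 / 2"
    by (simp add: power_divide power2_commute[of u v])
  finally have rhs: "(\<Sum>i\<in>S. (vnorm (col X i - column_mean 1 S X))\<^sup>2) = (v - u)\<^sup>2 / 2" .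
  show "(vnorm (biased_mean (sqrt \<kappa>) X - column_mean 1 S X))\<^sup>2
      \<le> \<kappa> / real (2 - 0) * (\<Sum>i\<in>S. (vnorm (col X i - column_mean 1 S X))\<^sup>2)"
    unfolding lhs rhs by simp
qed

section \<open>Contraction of the momentum recurrence\<close>

text \<open>
  In the coordinates \<open>e\<close> and \<open>v = a - \<rho> * e\<close>, the lag of the momentum behind the gradient, a step is
  nearly diagonal: \<open>e\<close> is multiplied by \<open>1 - \<gamma> * \<rho>\<close> and \<open>v\<close> by about \<open>\<beta>\<close>, while \<open>v\<close> leaks into \<open>e\<close>
  with weight at most \<open>\<gamma>\<close> and \<open>e\<close> into \<open>v\<close> with weight \<open>\<gamma> * \<rho>\<^sup>2\<close>. The weight of \<open>\<bar>v\<bar>\<close> has to stay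
  below \<open>1\<close> for the decrease of \<open>e\<close> to absorb the leak into \<open>v\<close>, and away from \<open>0\<close> for the gap
  \<open>1 - \<beta> \<ge> 4 * \<gamma>\<close> to absorb the leak into \<open>e\<close>; the value \<open>1 / 2\<close> does both.
\<close>
lemma momentum_step_contracts:
  fixes \<rho> \<gamma> \<beta> e a e' a' :: real
  assumes \<rho>: "0 \<le> \<rho>" "\<rho> \<le> 1" and \<gamma>: "0 \<le> \<gamma>" and \<beta>: "0 \<le> \<beta>" "\<beta> + 4 * \<gamma> \<le> 1"
    and a': "a' = \<beta> * a + (1 - \<beta>) * (\<rho> * e)" and e': "e' = e - \<gamma> * a'"
  shows "\<bar>e'\<bar> + \<bar>a' - \<rho> * e'\<bar> / 2 \<le> (1 - \<rho> * \<gamma> / 2) * (\<bar>e\<bar> + \<bar>a - \<rho> * e\<bar> / 2)"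
proof -
  define v where "v = a - \<rho> * e"
  have \<rho>\<gamma>: "0 \<le> \<rho> * \<gamma>" "\<rho> * \<gamma> \<le> \<gamma>" using \<rho> \<gamma> by (simp_all add: mult_left_le_one_le)
  have "\<gamma> * \<rho> \<le> 1" using \<rho>\<gamma> \<beta> by (simp add: mult.commute)
  have "e' = (1 - \<gamma> * \<rho>) * e - \<gamma> * \<beta> * v"
    by (simp add: e' a' v_def algebra_simps)
  then have "\<bar>e'\<bar> \<le> \<bar>(1 - \<gamma> * \<rho>) * e\<bar> + \<bar>\<gamma> * \<beta> * v\<bar>" by linarith
  also have "\<dots> = (1 - \<gamma> * \<rho>) * \<bar>e\<bar> + \<gamma> * \<beta> * \<bar>v\<bar>"
    using \<open>\<gamma> * \<rho> \<le> 1\<close> \<gamma> \<beta> by (simp add: abs_mult)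
  finally have 1: "\<bar>e'\<bar> \<le> (1 - \<gamma> * \<rho>) * \<bar>e\<bar> + \<gamma> * \<beta> * \<bar>v\<bar>" .
  have "a' - \<rho> * e' = \<beta> * (1 + \<rho> * \<gamma>) * v + \<rho> * (\<rho> * \<gamma>) * e"
    by (simp add: e' a' v_def algebra_simps)
  then have "\<bar>a' - \<rho> * e'\<bar> \<le> \<bar>\<beta> * (1 + \<rho> * \<gamma>) * v\<bar> + \<bar>\<rho> * (\<rho> * \<gamma>) * e\<bar>" by linarith
  also have "\<dots> = \<beta> * (1 + \<rho> * \<gamma>) * \<bar>v\<bar> + \<rho> * (\<rho> * \<gamma>) * \<bar>e\<bar>"
    using \<rho> \<gamma> \<beta> by (simp add: abs_mult)
  finally have 2: "\<bar>a' - \<rho> * e'\<bar> \<le> \<beta> * (1 + \<rho> * \<gamma>) * \<bar>v\<bar> + \<rho> * (\<rho> * \<gamma>) * \<bar>e\<bar>" .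
  have "\<rho> * (\<rho> * \<gamma>) \<le> \<rho> * \<gamma>" using \<rho> \<rho>\<gamma> by (simp add: mult_left_le_one_le)
  then have e_weight: "(1 - \<gamma> * \<rho>) + \<rho> * (\<rho> * \<gamma>) / 2 \<le> 1 - \<rho> * \<gamma> / 2"
    by (simp add: mult.commute)
  have "\<beta> * (1 + \<rho> * \<gamma> + 2 * \<gamma>) \<le> (1 - 4 * \<gamma>) * (1 + 3 * \<gamma>)"
    by (rule mult_mono) (use \<rho>\<gamma> \<beta> \<gamma> in auto)
  also have "\<dots> \<le> 1 - \<gamma>" using \<gamma> by (simp add: algebra_simps)
  finally have "\<beta> * (1 + \<rho> * \<gamma> + 2 * \<gamma>) \<le> 1 - \<gamma>" .
  moreover have "\<gamma> * \<beta> + \<beta> * (1 + \<rho> * \<gamma>) / 2 = \<beta> * (1 + \<rho> * \<gamma> + 2 * \<gamma>) / 2"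
    by (simp add: field_simps)
  moreover have "1 - \<gamma> \<le> 1 - \<rho> * \<gamma> / 2" using \<rho>\<gamma> by simp
  ultimately have v_weight: "\<gamma> * \<beta> + \<beta> * (1 + \<rho> * \<gamma>) / 2 \<le> (1 - \<rho> * \<gamma> / 2) / 2"
    by (simp only: divide_right_mono order_trans zero_le_numeral)
  have "\<bar>e'\<bar> + \<bar>a' - \<rho> * e'\<bar> / 2
      \<le> ((1 - \<gamma> * \<rho>) + \<rho> * (\<rho> * \<gamma>) / 2) * \<bar>e\<bar> + (\<gamma> * \<beta> + \<beta> * (1 + \<rho> * \<gamma>) / 2) * \<bar>v\<bar>"
    using 1 2 unfolding distrib_right add_divide_distrib times_divide_eq_left by linarith
  also have "\<dots> \<le> (1 - \<rho> * \<gamma> / 2) * \<bar>e\<bar> + (1 - \<rho> * \<gamma> / 2) / 2 * \<bar>v\<bar>"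
    using e_weight v_weight by (intro add_mono mult_right_mono) auto
  finally show ?thesis by (simp add: v_def algebra_simps)
qed

lemma momentum_error_decays:
  fixes \<rho> :: real and \<gamma> \<beta> e a :: "nat \<Rightarrow> real"
  assumes \<rho>: "0 \<le> \<rho>" "\<rho> \<le> 1"
    and sched: "\<And>t. 0 \<le> \<gamma> t" "\<And>t. 0 \<le> \<beta> t" "\<And>t. \<beta> t + 4 * \<gamma> t \<le> 1"
    and a: "\<And>t. Suc t \<le> T \<Longrightarrow> a (Suc t) = \<beta> (Suc t) * a t + (1 - \<beta> (Suc t)) * (\<rho> * e t)"
    and e: "\<And>t. Suc t \<le> T \<Longrightarrow> e (Suc t) = e t - \<gamma> (Suc t) * a (Suc t)"
    and "t \<le> T"
  shows "\<bar>e t\<bar> \<le> exp (- \<rho> / 2 * (\<Sum>s = 1..t. \<gamma> s)) * (\<bar>e 0\<bar> + \<bar>a 0 - \<rho> * e 0\<bar> / 2)"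
proof -
  define V where "V t = \<bar>e t\<bar> + \<bar>a t - \<rho> * e t\<bar> / 2" for t
  have "V t \<le> exp (- \<rho> / 2 * (\<Sum>s = 1..t. \<gamma> s)) * V 0"
    using \<open>t \<le> T\<close>
  proof (induction t)
    case 0
    then show ?case by simp
  next
    case (Suc t)
    have "V (Suc t) \<le> (1 - \<rho> * \<gamma> (Suc t) / 2) * V t"
      unfolding V_def
      by (rule momentum_step_contracts[OF \<rho> sched a[OF Suc.prems] e[OF Suc.prems]])
    also have "\<dots> \<le> exp (- \<rho> / 2 * \<gamma> (Suc t)) * V t"
      using exp_ge_add_one_self[of "- \<rho> / 2 * \<gamma> (Suc t)"]
      by (intro mult_right_mono) (auto simp: V_def)
    also have "\<dots> \<le> exp (- \<rho> / 2 * \<gamma> (Suc t)) * (exp (- \<rho> / 2 * (\<Sum>s = 1..t. \<gamma> s)) * V 0)"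
      using Suc by (intro mult_left_mono) auto
    also have "\<dots> = exp (- \<rho> / 2 * (\<Sum>s = 1..Suc t. \<gamma> s)) * V 0"
      by (simp add: mult_exp_exp algebra_simps)
    finally show ?case .
  qed
  moreover have "\<bar>e t\<bar> \<le> V t" by (simp add: V_def)
  ultimately show ?thesis unfolding V_def by linarith
qed

section \<open>Admissible schedules\<close>

lemma two_phase_stepsize_bounds:
  assumes "0 < \<alpha>" "0 < s0"
  shows "0 \<le> two_phase_stepsize \<alpha> s0 T t" "two_phase_stepsize \<alpha> s0 T t \<le> 2 / (\<alpha> * s0)"
proof -
  have pos: "0 < \<alpha> * s0" using assms by simp
  have "2 / (\<alpha> * (s0 + real t - real (T div 2))) \<le> 2 / (\<alpha> * s0)"
    and "0 \<le> 2 / (\<alpha> * (s0 + real t - real (T div 2)))" if "\<not> t < T div 2"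
  proof -
    have "\<alpha> * s0 \<le> \<alpha> * (s0 + real t - real (T div 2))"
      using assms that by (intro mult_left_mono) auto
    with pos show "2 / (\<alpha> * (s0 + real t - real (T div 2))) \<le> 2 / (\<alpha> * s0)"
      by (intro frac_le) auto
    show "0 \<le> 2 / (\<alpha> * (s0 + real t - real (T div 2)))"
      using pos \<open>\<alpha> * s0 \<le> _\<close> by (intro divide_nonneg_nonneg) linarith+
  qed
  then show "0 \<le> two_phase_stepsize \<alpha> s0 T t"
      "two_phase_stepsize \<alpha> s0 T t \<le> 2 / (\<alpha> * s0)"
    using pos by (simp_all add: two_phase_stepsize_def)
qed

lemma div_sqrt_le:
  fixes g :: real
  assumes "0 \<le> g"
  shows "g / sqrt (real T) \<le> g"
  using assms by (cases "T = 0") (auto simp: divide_le_eq mult_le_cancel_left1)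

lemma admissible_schedule_bounds:
  assumes "admissible_schedule \<kappa> B 1 \<gamma> \<beta>"
  shows "0 \<le> \<gamma> T t" and "0 \<le> \<beta> T t" and "\<beta> T t + 4 * \<gamma> T t \<le> 1"
proof -
  from assms have "0 \<le> \<gamma> T t \<and> 0 \<le> \<beta> T t \<and> \<beta> T t + 4 * \<gamma> T t \<le> 1"
  proof cases
    case (RDGD_const \<delta> \<gamma>0)
    then show ?thesis by (auto simp: admissible_delta_def)
  next
    case (RDGD_sqrt \<delta> \<gamma>0)
    then show ?thesis using div_sqrt_le[of \<gamma>0 T] by (auto simp: admissible_delta_def)
  next
    case (RDGD_two_phase \<delta> \<alpha> s0)
    then show ?thesis
      using two_phase_stepsize_bounds[of \<alpha> s0 T t] by (auto simp: admissible_delta_def)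
  next
    case (RDGDM_const \<gamma>0)
    then show ?thesis by auto
  next
    case (RDGDM_sqrt \<gamma>0)
    then show ?thesis using div_sqrt_le[of \<gamma>0 T] by auto
  next
    case (RDGDM_two_phase \<alpha> s0)
    have "2 / (\<alpha> * s0) \<le> 1 / 32" using RDGDM_two_phase by simp
    then have "two_phase_stepsize \<alpha> s0 T t \<le> 1 / 32"
      using RDGDM_two_phase two_phase_stepsize_bounds(2)[of \<alpha> s0 T t] by linarith
    then show ?thesis
      using RDGDM_two_phase two_phase_stepsize_bounds(1)[of \<alpha> s0 T t] by simp
  qed
  then show "0 \<le> \<gamma> T t" and "0 \<le> \<beta> T t" and "\<beta> T t + 4 * \<gamma> T t \<le> 1" by auto
qed

lemma sum_constant_stepsizes_diverges:
  "0 < g \<Longrightarrow> filterlim (\<lambda>T::nat. \<Sum>t = 1..T - 1. g) at_top sequentially"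
  for g :: real
  by (simp, real_asymp)

lemma sum_sqrt_stepsizes_diverges:
  "0 < g \<Longrightarrow> filterlim (\<lambda>T::nat. \<Sum>t = 1..T - 1. g / sqrt (real T)) at_top sequentially"
  for g :: real
  by (simp, real_asymp)

text \<open>The constant first phase alone contributes about \<open>T / 2\<close> equal steps.\<close>
lemma sum_two_phase_stepsizes_diverges:
  assumes "0 < \<alpha>" "0 < s0"
  shows "filterlim (\<lambda>T. \<Sum>t = 1..T - 1. two_phase_stepsize \<alpha> s0 T t) at_top sequentially"
proof (rule filterlim_at_top_mono)
  show "filterlim (\<lambda>T. (real T / 2 - 2) * (2 / (\<alpha> * s0))) at_top sequentially"
    using assms by real_asymp
  show "\<forall>\<^sub>F T in sequentially. (real T / 2 - 2) * (2 / (\<alpha> * s0))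
      \<le> (\<Sum>t = 1..T - 1. two_phase_stepsize \<alpha> s0 T t)"
  proof (rule always_eventually, rule allI)
    fix T :: nat
    have "(real T / 2 - 2) * (2 / (\<alpha> * s0)) \<le> real (card {1..<T div 2}) * (2 / (\<alpha> * s0))"
      using assms by (intro mult_right_mono) auto
    also have "\<dots> = (\<Sum>t\<in>{1..<T div 2}. two_phase_stepsize \<alpha> s0 T t)"
      by (simp add: two_phase_stepsize_def)
    also have "\<dots> \<le> (\<Sum>t = 1..T - 1. two_phase_stepsize \<alpha> s0 T t)"
      using two_phase_stepsize_bounds[OF assms] by (intro sum_mono2) auto
    finally show "(real T / 2 - 2) * (2 / (\<alpha> * s0))
      \<le> (\<Sum>t = 1..T - 1. two_phase_stepsize \<alpha> s0 T t)" .
  qed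
qed

lemma admissible_stepsizes_sum_diverges:
  assumes "admissible_schedule \<kappa> B L \<gamma> \<beta>"
  shows "filterlim (\<lambda>T. \<Sum>t = 1..T - 1. \<gamma> T t) at_top sequentially"
  using assms
  by cases (simp_all only: sum_constant_stepsizes_diverges sum_sqrt_stepsizes_diverges
      sum_two_phase_stepsizes_diverges less_trans[OF zero_less_numeral])

section \<open>The run on the two workers\<close>

text \<open>
  The two signs of the disagreement \<open>p + q * x\<close> turn the tilt of the rule into the bias
  \<open>- k * (p + q * x)\<close>, and linearity lets the aggregate inherit the momentum recurrence of the
  workers. The point \<open>y\<close> is where the aggregated gradient vanishes.
\<close>
lemma run_converges_to_biased_point:
  fixes k p q y :: real
  assumes run: "RDGDM_run 1 2 {0, 1} (two_workers p q) (biased_mean k) \<gamma> \<beta> T x0 x m"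
    and x0: "x0 \<in> carrier_vec 1"
    and \<rho>: "0 \<le> 1 - k * q" "1 - k * q \<le> 1"
    and sched: "\<And>t. 0 \<le> \<gamma> t" "\<And>t. 0 \<le> \<beta> t" "\<And>t. \<beta> t + 4 * \<gamma> t \<le> 1"
    and y: "y = k * (p + q * y)"
    and t: "t \<le> T"
  shows "x t \<in> carrier_vec 1"
    and "\<bar>x t $ 0 - y\<bar> \<le> exp (- (1 - k * q) / 2 * (\<Sum>s = 1..t. \<gamma> s)) * (2 * \<bar>x0 $ 0 - y\<bar>)"
proof -
  define a where "a t = biased_mean k (mat_of_cols 1 (map (m t) [0..<2])) $ 0" for t
  have a_eq: "a t = ((1 - k) * m t 0 $ 0 + (1 + k) * m t 1 $ 0) / 2" for t
    by (simp only: a_def biased_mean_of_cols)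
  have x_0: "x 0 = x0" and m_0: "\<And>i. i \<in> {0, 1} \<Longrightarrow> m 0 i = 0\<^sub>v 1"
    using run by (auto simp: RDGDM_run_def)
  have step: "(\<forall>i\<in>{0, 1}. m (Suc t) i = \<beta> (Suc t) \<cdot>\<^sub>v m t i
        + (1 - \<beta> (Suc t)) \<cdot>\<^sub>v gradient 1 (two_workers p q i) (x t)) \<and>
      x (Suc t) = x t - \<gamma> (Suc t) \<cdot>\<^sub>v biased_mean k (mat_of_cols 1 (map (m (Suc t)) [0..<2]))"
    if "Suc t \<le> T" for t
  proof -
    have "\<forall>s\<in>{1..T}. (\<forall>i\<in>{0, 1}. m s i = \<beta> s \<cdot>\<^sub>v m (s - 1) i
        + (1 - \<beta> s) \<cdot>\<^sub>v gradient 1 (two_workers p q i) (x (s - 1))) \<and>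
      x s = x (s - 1) - \<gamma> s \<cdot>\<^sub>v biased_mean k (mat_of_cols 1 (map (m s) [0..<2]))"
      using run unfolding RDGDM_run_def by blast
    moreover have "Suc t \<in> {1..T}" using that by simp
    ultimately show ?thesis using diff_Suc_1[of t] by metis
  qed
  have m_Suc: "m (Suc t) i = \<beta> (Suc t) \<cdot>\<^sub>v m t i
      + (1 - \<beta> (Suc t)) \<cdot>\<^sub>v gradient 1 (two_workers p q i) (x t)"
    if "Suc t \<le> T" "i \<in> {0, 1}" for t i
    using step that by blast
  have x_Suc: "x (Suc t) = x t - \<gamma> (Suc t) \<cdot>\<^sub>v biased_mean k (mat_of_cols 1 (map (m (Suc t)) [0..<2]))"
    if "Suc t \<le> T" for t
    using step that by blast
  have x_dim: "x t \<in> carrier_vec 1" if "t \<le> T" for t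
  proof (cases t)
    case (Suc s)
    have "dim_vec (x (Suc s)) = 1"
      using that Suc by (subst x_Suc) auto
    then show ?thesis unfolding Suc by (rule carrier_vecI)
  next
    case 0
    then show ?thesis using x0 by (simp only: x_0)
  qed
  show "x t \<in> carrier_vec 1" by (rule x_dim[OF t])
  have grad_dim: "gradient 1 (two_workers p q i) (x t) \<in> carrier_vec 1" if "t \<le> T" for t i
    using x_dim[OF that] by (simp add: two_workers_def gradient_quadratic)
  have m_dim: "m t i \<in> carrier_vec 1" if "t \<le> T" "i \<in> {0, 1}" for t i
  proof (cases t)
    case (Suc s)
    have "dim_vec (m (Suc s) i) = 1"
      using that Suc grad_dim[of s i] by (subst m_Suc) auto
    then show ?thesis unfolding Suc by (rule carrier_vecI)
  next
    case 0
    then show ?thesis using m_0[OF that(2)] by simp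
  qed
  have m_entry: "m (Suc t) i $ 0 = \<beta> (Suc t) * m t i $ 0
      + (1 - \<beta> (Suc t)) * (gradient 1 (two_workers p q i) (x t) $ 0)"
    if "Suc t \<le> T" "i \<in> {0, 1}" for t i
    using m_dim[of t i] grad_dim[of t i] that by (subst m_Suc[OF that]) auto
  have a_Suc: "a (Suc t) = \<beta> (Suc t) * a t
      + (1 - \<beta> (Suc t)) * ((1 - k * q) * (x t $ 0 - y))" if "Suc t \<le> T" for t
  proof -
    define z where "z = x t $ 0"
    let ?g = "\<lambda>i. gradient 1 (two_workers p q i) (x t) $ 0"
    have gradients: "?g 0 = z + (p + q * z)" "?g 1 = z - (p + q * z)"
      using x_dim[of t] that
      by (simp_all add: two_workers_def gradient_quadratic z_def algebra_simps)
    have "a (Suc t) = \<beta> (Suc t) * a t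
        + (1 - \<beta> (Suc t)) * (((1 - k) * ?g 0 + (1 + k) * ?g 1) / 2)"
      using that by (simp add: a_eq m_entry field_simps)
    also have "((1 - k) * ?g 0 + (1 + k) * ?g 1) / 2 = z - k * (p + q * z)"
      unfolding gradients by (simp add: field_simps)
    also have "z - k * (p + q * z) = (1 - k * q) * (z - y) + (y - k * (p + q * y))"
      by (simp add: algebra_simps)
    also have "y - k * (p + q * y) = 0" using y by linarith
    finally show ?thesis by (simp add: z_def)
  qed
  have e_Suc: "x (Suc t) $ 0 - y = (x t $ 0 - y) - \<gamma> (Suc t) * a (Suc t)" if "Suc t \<le> T" for t
    using that unfolding a_def by (subst x_Suc) auto
  have "\<bar>x t $ 0 - y\<bar> \<le> exp (- (1 - k * q) / 2 * (\<Sum>s = 1..t. \<gamma> s))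
      * (\<bar>x 0 $ 0 - y\<bar> + \<bar>a 0 - (1 - k * q) * (x 0 $ 0 - y)\<bar> / 2)"
    by (rule momentum_error_decays[where \<beta> = \<beta> and T = T])
      (fact \<rho> sched a_Suc e_Suc t)+
  also have "\<dots> \<le> exp (- (1 - k * q) / 2 * (\<Sum>s = 1..t. \<gamma> s)) * (2 * \<bar>x0 $ 0 - y\<bar>)"
  proof (rule mult_left_mono)
    define w where "w = (1 - k * q) * (x0 $ 0 - y)"
    have "\<bar>w\<bar> \<le> \<bar>x0 $ 0 - y\<bar>"
      using \<rho> by (simp add: w_def abs_mult mult_left_le_one_le)
    moreover have a_0: "a 0 = 0" by (simp add: a_eq m_0)
    ultimately show "\<bar>x 0 $ 0 - y\<bar> + \<bar>a 0 - (1 - k * q) * (x 0 $ 0 - y)\<bar> / 2 \<le> 2 * \<bar>x0 $ 0 - y\<bar>"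
      unfolding x_0 a_0 w_def[symmetric] by (smt (verit) field_sum_of_halves)
  qed simp
  finally show "\<bar>x t $ 0 - y\<bar>
      \<le> exp (- (1 - k * q) / 2 * (\<Sum>s = 1..t. \<gamma> s)) * (2 * \<bar>x0 $ 0 - y\<bar>)" .
qed

text \<open>
  Half of the way to the biased point costs a factor \<open>4\<close> in the squared gradient. A bias of zero
  is split off because convergence gives no strict inequality to work with then.
\<close>
lemma eventually_square_ge_quarter_of_bias:
  fixes k p q y :: real
  assumes sched: "admissible_schedule \<kappa> B 1 \<gamma> \<beta>" and x0: "x0 \<in> carrier_vec 1"
    and \<rho>: "0 < 1 - k * q" "1 - k * q \<le> 1"
    and y: "y = k * (p + q * y)" "0 \<le> y"
  shows "\<exists>T0. \<forall>T\<ge>T0. \<forall>x m.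
    RDGDM_run 1 2 {0, 1} (two_workers p q) (biased_mean k) (\<gamma> T) (\<beta> T) T x0 x m \<longrightarrow>
      x (T - 1) \<in> carrier_vec 1 \<and> y\<^sup>2 / 4 \<le> (x (T - 1) $ 0)\<^sup>2"
proof -
  define \<epsilon> where
    "\<epsilon> T = exp (- (1 - k * q) / 2 * (\<Sum>s = 1..T - 1. \<gamma> T s)) * (2 * \<bar>x0 $ 0 - y\<bar>)" for T
  have conv: "x (T - 1) \<in> carrier_vec 1" "\<bar>x (T - 1) $ 0 - y\<bar> \<le> \<epsilon> T"
    if "RDGDM_run 1 2 {0, 1} (two_workers p q) (biased_mean k) (\<gamma> T) (\<beta> T) T x0 x m" for T x m
    using run_converges_to_biased_point[OF that x0 less_imp_le[OF \<rho>(1)] \<rho>(2)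
        admissible_schedule_bounds[OF sched] y(1), of "T - 1"]
    by (auto simp: \<epsilon>_def)
  show ?thesis
  proof (cases "y = 0")
    case True
    then show ?thesis using conv(1) by auto
  next
    case False
    have "filterlim (\<lambda>T. - (1 - k * q) / 2 * (\<Sum>s = 1..T - 1. \<gamma> T s)) at_bot sequentially"
      using \<rho>(1) admissible_stepsizes_sum_diverges[OF sched]
      by (intro filterlim_tendsto_neg_mult_at_bot[OF tendsto_const]) auto
    then have "(\<lambda>T. exp (- (1 - k * q) / 2 * (\<Sum>s = 1..T - 1. \<gamma> T s))) \<longlonglongrightarrow> 0"
      by (rule filterlim_compose[OF exp_at_bot])
    then have "\<epsilon> \<longlonglongrightarrow> 0"
      unfolding \<epsilon>_def by (rule tendsto_mult_left_zero)
    then have "\<forall>\<^sub>F T in sequentially. \<epsilon> T < y / 2"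
      using False y(2) by (intro order_tendstoD) auto
    then obtain T0 where T0: "\<And>T. T \<ge> T0 \<Longrightarrow> \<epsilon> T < y / 2"
      by (auto simp: eventually_sequentially)
    have "y\<^sup>2 / 4 \<le> z\<^sup>2" if "\<bar>z - y\<bar> \<le> \<epsilon> T" "T \<ge> T0" for z T
    proof -
      have "y / 2 \<le> z" using that T0[of T] by linarith
      then have "(y / 2)\<^sup>2 \<le> z\<^sup>2" using y(2) by (intro power_mono) auto
      then show ?thesis by (simp add: power_divide)
    qed
    then show ?thesis using conv by blast
  qed
qed

section \<open>The lower bound\<close>

theorem theorem4p1:
  shows "\<exists>c::real. 0 < c \<and>
    (\<forall>(G::real) (B::real) (\<kappa>::real). 0 \<le> G \<and> 0 \<le> B \<and> 0 \<le> \<kappa> \<and> \<kappa> * B\<^sup>2 < 1 \<longrightarrow>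
      (\<exists>(d::nat) (n::nat) (b::nat) (H::nat set) (f::nat \<Rightarrow> real vec \<Rightarrow> real)
         (\<mu>::real) (xmin::real vec) (A::real mat \<Rightarrow> real vec).
        distributed_problem d n b H f \<and>
        0 < \<mu> \<and> smooth d \<mu> (honest_objective H f) \<and> PL_condition d \<mu> (honest_objective H f) \<and>
        bounded_dissimilarity d H f G B \<and>
        is_arg_min (honest_objective H f) (\<lambda>x. x \<in> carrier_vec d) xmin \<and>
        aggregation_rule d n A \<and> robust d n b \<kappa> A \<and>
        (\<forall>\<gamma> \<beta> x0. admissible_schedule \<kappa> B \<mu> \<gamma> \<beta> \<and> x0 \<in> carrier_vec d \<longrightarrow>
          (\<exists>T0. \<forall>T\<ge>T0. \<forall>x m. RDGDM_run d n H f A (\<gamma> T) (\<beta> T) T x0 x m \<longrightarrow>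
            (vnorm (gradient d (honest_objective H f) (x (T - 1))))\<^sup>2
              \<ge> c * (\<kappa> * G\<^sup>2 / (1 - \<kappa> * B\<^sup>2)) \<and>
            honest_objective H f (x (T - 1)) - honest_objective H f xmin
              \<ge> c * (\<kappa> * G\<^sup>2 / (\<mu> * (1 - \<kappa> * B\<^sup>2)))))))"
proof (rule exI[of _ "1 / 8"], rule conjI, simp, rule allI, rule allI, rule allI, rule impI)
  fix G B \<kappa> :: real
  assume "0 \<le> G \<and> 0 \<le> B \<and> 0 \<le> \<kappa> \<and> \<kappa> * B\<^sup>2 < 1"
  then have G: "0 \<le> G" and \<kappa>: "0 \<le> \<kappa>" and \<kappa>B: "\<kappa> * B\<^sup>2 < 1" by auto
  (* p + q * x is the tangent line of the hyperbola at y, so y is also where the run ends up. *)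
  define k p q y where "k = sqrt \<kappa>" and "p = G * sqrt (1 - \<kappa> * B\<^sup>2)"
    and "q = sqrt \<kappa> * B\<^sup>2" and "y = sqrt \<kappa> * G / sqrt (1 - \<kappa> * B\<^sup>2)"
  have kq: "k * q = \<kappa> * B\<^sup>2"
    using \<kappa> by (simp add: k_def q_def flip: mult.assoc)
  have \<rho>: "0 < 1 - k * q" "1 - k * q \<le> 1" using \<kappa> \<kappa>B by (simp_all add: kq)
  have "(1 - k * q) * y = sqrt \<kappa> * G * ((1 - \<kappa> * B\<^sup>2) / sqrt (1 - \<kappa> * B\<^sup>2))"
    by (simp add: kq y_def)
  also have "\<dots> = k * p"
    using \<kappa>B by (simp only: real_div_sqrt k_def p_def mult.assoc diff_ge_0_iff_ge less_imp_le)
  finally have "k * p = (1 - k * q) * y" ..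
  then have y_fixed: "y = k * (p + q * y)" by (simp add: algebra_simps)
  have y_nonneg: "0 \<le> y" using G \<kappa> \<kappa>B by (simp add: y_def)
  have y_square: "y\<^sup>2 = \<kappa> * G\<^sup>2 / (1 - \<kappa> * B\<^sup>2)"
    using \<kappa> \<kappa>B by (simp add: y_def power_divide power_mult_distrib)
  let ?F = "honest_objective {0, 1} (two_workers p q)"
  have bound: "\<exists>T0. \<forall>T\<ge>T0. \<forall>x m.
      RDGDM_run 1 2 {0, 1} (two_workers p q) (biased_mean k) (\<gamma> T) (\<beta> T) T x0 x m \<longrightarrow>
      (vnorm (gradient 1 ?F (x (T - 1))))\<^sup>2 \<ge> 1 / 8 * (\<kappa> * G\<^sup>2 / (1 - \<kappa> * B\<^sup>2)) \<and>
      ?F (x (T - 1)) - ?F (0\<^sub>v 1) \<ge> 1 / 8 * (\<kappa> * G\<^sup>2 / (1 * (1 - \<kappa> * B\<^sup>2)))"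
    if setting: "admissible_schedule \<kappa> B 1 \<gamma> \<beta> \<and> x0 \<in> carrier_vec 1" for \<gamma> \<beta> x0
  proof -
    have far: "(vnorm (gradient 1 ?F z))\<^sup>2 \<ge> 1 / 8 * (\<kappa> * G\<^sup>2 / (1 - \<kappa> * B\<^sup>2)) \<and>
        ?F z - ?F (0\<^sub>v 1) \<ge> 1 / 8 * (\<kappa> * G\<^sup>2 / (1 * (1 - \<kappa> * B\<^sup>2)))"
      if z: "z \<in> carrier_vec 1" "y\<^sup>2 / 4 \<le> (z $ 0)\<^sup>2" for z
    proof -
      have "(vnorm (gradient 1 ?F z))\<^sup>2 = (z $ 0)\<^sup>2"
        using z(1) unfolding honest_objective_two_workers
        by (simp add: vnorm_gradient_quadratic)
      moreover have "?F z - ?F (0\<^sub>v 1) = (z $ 0)\<^sup>2 / 2"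
        unfolding honest_objective_two_workers by (simp add: quadratic_def)
      moreover have "y\<^sup>2 / 8 \<le> (z $ 0)\<^sup>2" "y\<^sup>2 / 8 \<le> (z $ 0)\<^sup>2 / 2"
        using z(2) zero_le_power2[of y] by linarith+
      ultimately have "1 / 8 * y\<^sup>2 \<le> (vnorm (gradient 1 ?F z))\<^sup>2"
          and "1 / 8 * y\<^sup>2 \<le> ?F z - ?F (0\<^sub>v 1)"
        by linarith+
      then show ?thesis by (simp only: y_square mult_1_left simp_thms)
    qed
    obtain T0 where T0: "\<forall>T\<ge>T0. \<forall>x m.
        RDGDM_run 1 2 {0, 1} (two_workers p q) (biased_mean k) (\<gamma> T) (\<beta> T) T x0 x m \<longrightarrow>
        x (T - 1) \<in> carrier_vec 1 \<and> y\<^sup>2 / 4 \<le> (x (T - 1) $ 0)\<^sup>2"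
      using eventually_square_ge_quarter_of_bias[OF conjunct1[OF setting] conjunct2[OF setting]
          \<rho> y_fixed y_nonneg] ..
    show ?thesis
    proof (rule exI[of _ T0], rule allI, rule impI, rule allI, rule allI, rule impI)
      fix T x m
      assume "T0 \<le> T"
        and run: "RDGDM_run 1 2 {0, 1} (two_workers p q) (biased_mean k) (\<gamma> T) (\<beta> T) T x0 x m"
      with T0 have "x (T - 1) \<in> carrier_vec 1 \<and> y\<^sup>2 / 4 \<le> (x (T - 1) $ 0)\<^sup>2"
        by blast
      then show "(vnorm (gradient 1 ?F (x (T - 1))))\<^sup>2 \<ge> 1 / 8 * (\<kappa> * G\<^sup>2 / (1 - \<kappa> * B\<^sup>2)) \<and>
          ?F (x (T - 1)) - ?F (0\<^sub>v 1) \<ge> 1 / 8 * (\<kappa> * G\<^sup>2 / (1 * (1 - \<kappa> * B\<^sup>2)))"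
        by (elim conjE) (rule far)
    qed
  qed
  have minimum: "is_arg_min ?F (\<lambda>x. x \<in> carrier_vec 1) (0\<^sub>v 1)"
    unfolding honest_objective_two_workers
    by (auto simp: is_arg_min_def quadratic_def not_less)
  have dissimilar: "bounded_dissimilarity 1 {0, 1} (two_workers p q) G B"
    unfolding p_def q_def
    by (intro bounded_dissimilarity_two_workers tangent_line_below_hyperbola \<kappa>
        less_imp_le[OF \<kappa>B])
  have smooth_PL: "smooth 1 1 ?F" "PL_condition 1 1 ?F"
    unfolding honest_objective_two_workers
    by (rule smooth_half_square PL_condition_half_square)+
  have robust: "robust 1 2 0 \<kappa> (biased_mean k)"
    unfolding k_def by (rule robust_biased_mean[OF \<kappa>])
  show "\<exists>(d::nat) (n::nat) (b::nat) (H::nat set) (f::nat \<Rightarrow> real vec \<Rightarrow> real)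
         (\<mu>::real) (xmin::real vec) (A::real mat \<Rightarrow> real vec).
        distributed_problem d n b H f \<and>
        0 < \<mu> \<and> smooth d \<mu> (honest_objective H f) \<and> PL_condition d \<mu> (honest_objective H f) \<and>
        bounded_dissimilarity d H f G B \<and>
        is_arg_min (honest_objective H f) (\<lambda>x. x \<in> carrier_vec d) xmin \<and>
        aggregation_rule d n A \<and> robust d n b \<kappa> A \<and>
        (\<forall>\<gamma> \<beta> x0. admissible_schedule \<kappa> B \<mu> \<gamma> \<beta> \<and> x0 \<in> carrier_vec d \<longrightarrow>
          (\<exists>T0. \<forall>T\<ge>T0. \<forall>x m. RDGDM_run d n H f A (\<gamma> T) (\<beta> T) T x0 x m \<longrightarrow>
            (vnorm (gradient d (honest_objective H f) (x (T - 1))))\<^sup>2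
              \<ge> 1 / 8 * (\<kappa> * G\<^sup>2 / (1 - \<kappa> * B\<^sup>2)) \<and>
            honest_objective H f (x (T - 1)) - honest_objective H f xmin
              \<ge> 1 / 8 * (\<kappa> * G\<^sup>2 / (\<mu> * (1 - \<kappa> * B\<^sup>2)))))"
    by (rule exI[of _ 1], rule exI[of _ 2], rule exI[of _ 0], rule exI[of _ "{0, 1}"],
        rule exI[of _ "two_workers p q"], rule exI[of _ 1], rule exI[of _ "0\<^sub>v 1"],
        rule exI[of _ "biased_mean k"],
        intro conjI allI impI distributed_problem_two_workers smooth_PL dissimilar
          minimum aggregation_rule_biased_mean robust bound)
      simp_all
qed

end
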